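(* The hybrid exponential Euler method $$\tilde u_n^0=u_n+h\varphi_2(hJ_n)\bigl(g_n(u_n)+J_nu_n\bigr),\qquad u_{n+1}=u_n+hJ_n\tilde u_n^0+hg_n(u_n)$$ is second order, in the sense that its local truncation error $\hat e_{n+1}=\bar u_{n+1}-u(t_{n+1})$ satisfies $$\hat e_{n+1}=\mathcal O(h^3).$$
   Context: Let $X$ be a Banach space with norm $\|\cdot\|$, $T>0$, and consider $u'(t)=F(u(t))$, $u(0)=u_0$ on $[0,T]$. Assumption 1: $u\in C([0,T);X)\cap C^1((0,T);X)$, and $F:X\to X$ is sufficiently many times Fréchet differentiable in a strip along the exact solution $u$ with all derivatives uniformly bounded; hence the Jacobian $J(v)=\frac{\partial F}{\partial u}(v)$ satisfies $\|J(v)-J(w)\|_{\mathcal L(X)}\le C\|v-w\|$ in a neighborhood of the exact solution. Assumption 2: the linear operator $J=J(v)$ generates a strongly continuous semigroup on $X$, with constants $C,\omega$ such that $\|e^{tJ}\|_{\mathcal L(X)}\le Ce^{\omega t}$, $t\ge0$, uniformly in a neighborhood of the exact solution (i.e. for all $v$ there). Uniform grid: $0=t_0<\dots<t_N=T$, $h=t_{n+1}-t_n$; $u(T)$ is understood by continuity. $u_n\approx u(t_n)$ denotes the numerical solution, $J_n=\frac{\partial F}{\partial u}(u_n)$, $g_n(v)=F(v)-J_nv$. The $\varphi$-functions are $\varphi_0(z)=e^z$ and $\varphi_p(z)=\int_0^1e^{(1-\theta)z}\frac{\theta^{p-1}}{(p-1)!}\,d\theta$ for $p\ge1$; applied to $hJ$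 via the semigroup $e^{tJ}$. Local truncation error: put $\hat u_n=u(t_n)$, $\hat J_n=\frac{\partial F}{\partial u}(\hat u_n)$, $\hat g_n(v)=F(v)-\hat J_nv$. Then $\bar u_{n+1}$ is the result of one step of the method started from $\hat u_n$, i.e. with $u_n,J_n,g_n$ replaced by $\hat u_n,\hat J_n,\hat g_n$. $\mathcal O(h^k)$ means bounded in norm by $Ch^k$ as $h\to0$ with $C$ independent of $n$ and $h$. *)

theory Defs
  imports "HOL-Analysis.Analysis"
begin

definition C0_semigroup :: "(real \<Rightarrow> 'a::banach \<Rightarrow>\<^sub>L 'a) \<Rightarrow> bool" where
  "C0_semigroup S \<longleftrightarrow>
     S 0 = id_blinfun \<and>
     (\<forall>s\<ge>0. \<forall>t\<ge>0. S (s + t) = S s o\<^sub>L S t) \<and>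
     (\<forall>x. ((\<lambda>t. S t x) \<longlongrightarrow> x) (at_right 0))"

text \<open>
  The infinitesimal generator is given by its graph, so its domain is part of the data.
  Values of \<open>S\<close> at negative times are irrelevant.
\<close>

definition semigroup_generator :: "(real \<Rightarrow> 'a::banach \<Rightarrow>\<^sub>L 'a) \<Rightarrow> ('a \<times> 'a) set" where
  "semigroup_generator S = {(x, y). ((\<lambda>t. (S t x - x) /\<^sub>R t) \<longlongrightarrow> y) (at_right 0)}"

definition generates :: "('a::banach \<Rightarrow>\<^sub>L 'a) \<Rightarrow> (real \<Rightarrow> 'a \<Rightarrow>\<^sub>L 'a) \<Rightarrow> bool" where
  "generates A S \<longleftrightarrow>
     C0_semigroup S \<and> semigroup_generator S = {(x, y). y = blinfun_apply A x}"

text \<open>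
  \<open>phi p S h\<close> is the operator \<open>\<phi>\<^sub>p(hA)\<close>, where \<open>A\<close> is the generator of \<open>S\<close>:
  the factor \<open>e\<^bsup>(1-\<theta>)hA\<^esup>\<close> under the integral is \<open>S ((1 - \<theta>) * h)\<close>.
\<close>

definition phi :: "nat \<Rightarrow> (real \<Rightarrow> 'a::banach \<Rightarrow>\<^sub>L 'a) \<Rightarrow> real \<Rightarrow> 'a \<Rightarrow> 'a" where
  "phi p S h x =
     (if p = 0 then S h x
      else integral {0..1} (\<lambda>\<theta>. (\<theta> ^ (p - 1) / fact (p - 1)) *\<^sub>R S ((1 - \<theta>) * h) x))"

text \<open>
  For a function \<open>u\<close> that is continuous on \<open>{0..T}\<close>, every neighbourhood of the curve \<open>u ` {0..T}\<close>
  contains such a strip.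
\<close>

definition strip :: "(real \<Rightarrow> 'a::banach) \<Rightarrow> real \<Rightarrow> real \<Rightarrow> 'a set" where
  "strip u T \<delta> = (\<Union>t\<in>{0..T}. ball (u t) \<delta>)"

definition nonlinear_part ::
  "('a::banach \<Rightarrow> 'a) \<Rightarrow> ('a \<Rightarrow> 'a \<Rightarrow>\<^sub>L 'a) \<Rightarrow> 'a \<Rightarrow> 'a \<Rightarrow> 'a" where
  "nonlinear_part F J w v = F v - J w v"

text \<open>
  Here \<open>J v\<close> is the Jacobian of \<open>F\<close> at \<open>v\<close> and \<open>S v\<close> the semigroup it generates;
  \<open>w\<close> is the current value of the numerical solution, at which \<open>F\<close> is linearized.
\<close>

definition hybrid_euler_stage ::
  "('a::banach \<Rightarrow> 'a) \<Rightarrow> ('a \<Rightarrow> 'a \<Rightarrow>\<^sub>L 'a) \<Rightarrow> ('a \<Rightarrow> real \<Rightarrow> 'a \<Rightarrow>\<^sub>L 'a) \<Rightarrow> real \<Rightarrow> 'a \<Rightarrow> 'a" where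
  "hybrid_euler_stage F J S h w =
     w + h *\<^sub>R phi 2 (S w) h (nonlinear_part F J w w + J w w)"

definition hybrid_euler_step ::
  "('a::banach \<Rightarrow> 'a) \<Rightarrow> ('a \<Rightarrow> 'a \<Rightarrow>\<^sub>L 'a) \<Rightarrow> ('a \<Rightarrow> real \<Rightarrow> 'a \<Rightarrow>\<^sub>L 'a) \<Rightarrow> real \<Rightarrow> 'a \<Rightarrow> 'a" where
  "hybrid_euler_step F J S h w =
     w + h *\<^sub>R J w (hybrid_euler_stage F J S h w) + h *\<^sub>R nonlinear_part F J w w"

text \<open>\<open>local_error F J S u h n\<close> is the error committed in the step from \<open>n * h\<close> to \<open>Suc n * h\<close>.\<close>

definition local_error ::
  "('a::banach \<Rightarrow> 'a) \<Rightarrow> ('a \<Rightarrow> 'a \<Rightarrow>\<^sub>L 'a) \<Rightarrow> ('a \<Rightarrow> real \<Rightarrow> 'a \<Rightarrow>\<^sub>L 'a) \<Rightarrow>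
     (real \<Rightarrow> 'a) \<Rightarrow> real \<Rightarrow> nat \<Rightarrow> 'a" where
  "local_error F J S u h n =
     hybrid_euler_step F J S h (u (real n * h)) - u (real (Suc n) * h)"

end

theory Submission
  imports Defs
begin

text \<open>
  Since \<open>g w + J w w = F w\<close> at the point of linearization \<open>w\<close>, one step of the method is
  \<open>w + h F w + h\<^sup>2 J \<phi>\<^sub>2(hJ) (F w)\<close> with \<open>J = J w\<close>.  The solution has \<open>u' = F u\<close> and
  \<open>u'' = J (F u)\<close>, so both the method and the solution agree with
  \<open>w + h F w + h\<^sup>2/2 J (F w)\<close> up to \<open>O(h\<^sup>3)\<close> as soon as \<open>\<phi>\<^sub>2(hJ) = 1/2 + O(h)\<close> on the vector
  \<open>F w\<close> and \<open>u'''\<close> is bounded.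

  The first point (\<open>phi_2_minus_half_bound\<close>) needs an estimate \<open>\<parallel>S t x - x\<parallel> = O(t)\<close> that is
  uniform along the solution.  Writing \<open>S t x - x\<close> as a telescoping sum over \<open>m\<close> equal pieces
  bounds it by \<open>M t\<close> times the norm of the difference quotient at \<open>t / m\<close>, where \<open>M\<close> bounds the
  semigroup on \<open>{0..t}\<close>; the quotient tends to the generator applied to \<open>x\<close>.  For \<open>x = F w\<close>
  the resulting constant is uniform in \<open>w\<close>, because the semigroups and \<open>J\<close> are uniformly bounded
  by assumption and \<open>F\<close> is bounded on the solution curve by compactness.

  The second point (\<open>taylor_second_order_bound\<close>) follows by integrating the bound on \<open>u'''\<close>
  three times with the mean value inequality.  This inequality asks for derivatives in the interior
  of an interval but only for continuity at its endpoints, so it covers the first and the last step,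
  where the solution is known to be continuous at \<open>0\<close> and at \<open>T\<close>.
\<close>

section \<open>Semigroups near time zero\<close>

lemma semigroup_telescope_bound:
  assumes S: "C0_semigroup S"
    and M: "\<And>s. 0 \<le> s \<Longrightarrow> s \<le> t \<Longrightarrow> norm (S s) \<le> M"
    and "0 \<le> d" "real k * d \<le> t"
  shows "norm (S (real k * d) x - x) \<le> real k * (M * norm (S d x - x))"
  using \<open>real k * d \<le> t\<close>
proof (induction k)
  case 0
  then show ?case using S by (simp add: C0_semigroup_def)
next
  case (Suc k)
  have kd: "0 \<le> real k * d" "real k * d \<le> t"
    using Suc.prems \<open>0 \<le> d\<close> by (auto simp: algebra_simps)
  have "S (real k * d + d) = S (real k * d) o\<^sub>L S d"
    using S kd \<open>0 \<le> d\<close> by (simp add: C0_semigroup_def)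
  then have "S (real (Suc k) * d) x - x = S (real k * d) (S d x - x) + (S (real k * d) x - x)"
    by (simp add: algebra_simps blinfun.diff_right)
  also have "norm \<dots> \<le> norm (S (real k * d)) * norm (S d x - x) + norm (S (real k * d) x - x)"
    by (intro norm_triangle_le add_mono norm_blinfun order_refl)
  also have "\<dots> \<le> M * norm (S d x - x) + real k * (M * norm (S d x - x))"
    using Suc.IH kd by (intro add_mono mult_right_mono M) auto
  finally show ?case by (simp add: algebra_simps)
qed

text \<open>
  By the telescoping bound the left-hand side is at most \<open>M t\<close> times the norm of the difference
  quotient at \<open>t / m\<close>, for every \<open>m > 0\<close>.  Letting \<open>m\<close> tend to infinity puts the generator in its
  place, so differentiability of the orbit at zero already gives a bound on all of \<open>{0..t}\<close>.
\<close>

lemma generates_increment_bound: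
  assumes gen: "generates A S"
    and M: "\<And>s. 0 \<le> s \<Longrightarrow> s \<le> t \<Longrightarrow> norm (S s) \<le> M"
    and "0 \<le> t"
  shows "norm (S t x - x) \<le> M * norm (A x) * t"
proof (cases "t = 0")
  case True
  then show ?thesis using gen by (simp add: generates_def C0_semigroup_def)
next
  case False
  then have "t > 0" using \<open>0 \<le> t\<close> by simp
  define d where "d m = t / real (Suc m)" for m
  have d: "d m > 0" for m using \<open>t > 0\<close> by (simp add: d_def)
  have "d \<longlonglongrightarrow> 0"
    unfolding d_def by (intro LIMSEQ_Suc lim_const_over_n)
  then have "filterlim d (at_right 0) sequentially"
    using d by (auto simp: filterlim_at less_imp_neq[symmetric] intro!: always_eventually)
  moreover have "((\<lambda>s. (S s x - x) /\<^sub>R s) \<longlongrightarrow> A x) (at_right 0)"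
    using gen by (auto simp: generates_def semigroup_generator_def set_eq_iff)
  ultimately have "(\<lambda>m. (S (d m) x - x) /\<^sub>R d m) \<longlonglongrightarrow> A x"
    by (rule filterlim_compose[rotated])
  then have lim: "(\<lambda>m. M * norm ((S (d m) x - x) /\<^sub>R d m) * t) \<longlonglongrightarrow> M * norm (A x) * t"
    by (intro tendsto_intros)
  have "norm (S t x - x) \<le> M * norm ((S (d m) x - x) /\<^sub>R d m) * t" for m
  proof -
    have t: "real (Suc m) * d m = t" by (simp add: d_def)
    have "norm (S (real (Suc m) * d m) x - x) \<le> real (Suc m) * (M * norm (S (d m) x - x))"
      using gen d[of m] t M
      by (intro semigroup_telescope_bound[of S t M]) (auto simp: generates_def simp del: of_nat_Suc)
    also have "\<dots> = M * norm ((S (d m) x - x) /\<^sub>R d m) * (real (Suc m) * d m)"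
      using d[of m] by (simp del: of_nat_Suc)
    finally show ?thesis by (simp only: t)
  qed
  then show ?thesis
    using lim by (intro LIMSEQ_le_const) auto
qed

text \<open>
  Continuity of the orbits is what makes the integral that defines \<open>phi 2\<close> meaningful: the
  integral of a non-integrable function is \<open>0\<close>.
\<close>

lemma generates_orbit_continuous:
  assumes gen: "generates A S"
    and M: "\<And>s. 0 \<le> s \<Longrightarrow> s \<le> t \<Longrightarrow> norm (S s) \<le> M"
  shows "continuous_on {0..t} (\<lambda>s. S s x)"
proof (cases "0 \<le> t")
  case True
  then have "0 \<le> M" using M[of 0] norm_ge_zero order_trans by blast
  have mono: "norm (S s x - S r x) \<le> M * (M * norm (A x)) * (s - r)"
    if "0 \<le> r" "r \<le> s" "s \<le> t" for r s
  proof -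
    have "S (r + (s - r)) = S r o\<^sub>L S (s - r)"
      using gen that unfolding generates_def C0_semigroup_def by (meson diff_ge_0_iff_ge)
    then have "S s x - S r x = S r (S (s - r) x - x)"
      by (simp add: blinfun.diff_right)
    also have "norm \<dots> \<le> norm (S r) * norm (S (s - r) x - x)"
      by (rule norm_blinfun)
    also have "\<dots> \<le> M * (M * norm (A x) * (s - r))"
      using that \<open>0 \<le> M\<close> M by (intro mult_mono generates_increment_bound[OF gen]) auto
    finally show ?thesis by (simp add: mult.assoc)
  qed
  have "(M * (M * norm (A x)))-lipschitz_on {0..t} (\<lambda>s. S s x)"
  proof (rule lipschitz_onI)
    fix r s assume "r \<in> {0..t}" "s \<in> {0..t}"
    then show "dist (S r x) (S s x) \<le> M * (M * norm (A x)) * dist r s"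
      using mono[of r s] mono[of s r]
      by (cases "r \<le> s") (auto simp: dist_norm norm_minus_commute)
  qed (use \<open>0 \<le> M\<close> in simp)
  then show ?thesis by (rule lipschitz_on_continuous_on)
qed simp

text \<open>
  As \<open>\<integral> \<theta> = 1/2\<close> over the unit interval, the difference is the integral of
  \<open>\<theta> (S ((1 - \<theta>) h) x - x)\<close>.
\<close>

lemma phi_2_minus_half_bound:
  assumes gen: "generates A S"
    and M: "\<And>s. 0 \<le> s \<Longrightarrow> s \<le> h \<Longrightarrow> norm (S s) \<le> M"
    and "0 \<le> h"
  shows "norm (phi 2 S h x - x /\<^sub>R 2) \<le> M * norm (A x) * h"
proof -
  have "0 \<le> M" using M[of 0] \<open>0 \<le> h\<close> norm_ge_zero order_trans by blast
  have rng: "0 \<le> (1 - \<theta>) * h" "(1 - \<theta>) * h \<le> h" if "\<theta> \<in> {0..1}" for \<theta>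
    using that \<open>0 \<le> h\<close> by (auto simp: mult_left_le_one_le)
  have contS: "continuous_on {0..1} (\<lambda>\<theta>. \<theta> *\<^sub>R S ((1 - \<theta>) * h) x)"
    using rng
    by (intro continuous_intros
        continuous_on_compose2[OF generates_orbit_continuous[OF gen M]]) auto
  have cont: "continuous_on {0..1} (\<lambda>\<theta>. \<theta> *\<^sub>R S ((1 - \<theta>) * h) x - \<theta> *\<^sub>R x)"
    by (intro continuous_intros contS)
  have "((\<lambda>\<theta>::real. \<theta>) has_integral (1\<^sup>2 - 0\<^sup>2) / 2) {0..1}"
    by (intro ident_has_integral) simp
  then have "((\<lambda>\<theta>. \<theta> *\<^sub>R x) has_integral x /\<^sub>R 2) {0..1::real}"
    using has_integral_scaleR_left[of "\<lambda>\<theta>. \<theta>" "1/2" "{0..1}" x] by simp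
  moreover have "phi 2 S h x = integral {0..1} (\<lambda>\<theta>. \<theta> *\<^sub>R S ((1 - \<theta>) * h) x)"
    by (simp add: phi_def)
  ultimately have "phi 2 S h x - x /\<^sub>R 2 =
      integral {0..1} (\<lambda>\<theta>. \<theta> *\<^sub>R S ((1 - \<theta>) * h) x - \<theta> *\<^sub>R x)"
    using contS
    by (subst integral_diff)
       (auto intro: integrable_continuous_interval simp: integral_unique has_integral_integrable)
  also have "norm \<dots> \<le> M * norm (A x) * h * (1 - 0)"
  proof (rule integral_bound[OF _ cont])
    fix \<theta> :: real assume \<theta>: "\<theta> \<in> {0..1}"
    have "norm (\<theta> *\<^sub>R S ((1 - \<theta>) * h) x - \<theta> *\<^sub>R x) = \<theta> * norm (S ((1 - \<theta>) * h) x - x)"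
      using \<theta> by (simp flip: scaleR_diff_right)
    also have "\<dots> \<le> 1 * (M * norm (A x) * ((1 - \<theta>) * h))"
      using \<theta> rng[OF \<theta>] M by (intro mult_mono generates_increment_bound[OF gen]) auto
    also have "\<dots> \<le> M * norm (A x) * h"
      using rng[OF \<theta>] \<open>0 \<le> M\<close> by (simp add: mult_left_mono)
    finally show "norm (\<theta> *\<^sub>R S ((1 - \<theta>) * h) x - \<theta> *\<^sub>R x) \<le> M * norm (A x) * h" .
  qed simp
  finally show ?thesis by simp
qed

section \<open>Second-order expansions of the method and of the solution\<close>

lemma hybrid_euler_step_bound:
  assumes gen: "generates (J w) (S w)"
    and M: "\<And>s. 0 \<le> s \<Longrightarrow> s \<le> h \<Longrightarrow> norm (S w s) \<le> M"
    and "0 \<le> h"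
  shows "norm (hybrid_euler_step F J S h w - (w + h *\<^sub>R F w + (h\<^sup>2 / 2) *\<^sub>R J w (F w)))
    \<le> M * (norm (J w))\<^sup>2 * norm (F w) * h ^ 3"
proof -
  have "0 \<le> M" using M[of 0] \<open>0 \<le> h\<close> norm_ge_zero order_trans by blast
  have "hybrid_euler_step F J S h w - (w + h *\<^sub>R F w + (h\<^sup>2 / 2) *\<^sub>R J w (F w))
      = h\<^sup>2 *\<^sub>R J w (phi 2 (S w) h (F w) - F w /\<^sub>R 2)"
    by (simp add: hybrid_euler_step_def hybrid_euler_stage_def nonlinear_part_def
        blinfun.bilinear_simps algebra_simps power2_eq_square)
  also have "norm \<dots> \<le> h\<^sup>2 * (norm (J w) * (M * (norm (J w) * norm (F w)) * h))"
    unfolding norm_scaleR abs_power2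
  proof (intro mult_left_mono order_trans[OF norm_blinfun])
    have "norm (phi 2 (S w) h (F w) - F w /\<^sub>R 2) \<le> M * norm (J w (F w)) * h"
      using phi_2_minus_half_bound[OF gen M \<open>0 \<le> h\<close>] by blast
    also have "\<dots> \<le> M * (norm (J w) * norm (F w)) * h"
      using \<open>0 \<le> M\<close> \<open>0 \<le> h\<close> by (intro mult_right_mono mult_left_mono norm_blinfun)
    finally show "norm (phi 2 (S w) h (F w) - F w /\<^sub>R 2) \<le> M * (norm (J w) * norm (F w)) * h" .
  qed auto
  finally show ?thesis by (simp add: power2_eq_square power3_eq_cube ac_simps)
qed

text \<open>
  The mean value inequality compares a curve with a scalar function that dominates its speed.
  Applied to \<open>q\<close>, to the remainder of \<open>v\<close> and to that of \<open>y\<close>, with \<open>L s\<close>, \<open>L s\<^sup>2/2\<close> and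
  \<open>L s\<^sup>3/6\<close> as the scalar functions, it plays the role of integration.
\<close>

lemma taylor_second_order_bound:
  fixes y v q r :: "real \<Rightarrow> 'a::real_normed_vector"
  assumes "0 \<le> h"
    and cont: "continuous_on {a..a + h} y" "continuous_on {a..a + h} v" "continuous_on {a..a + h} q"
    and y': "\<And>t. a < t \<Longrightarrow> t < a + h \<Longrightarrow> (y has_vector_derivative v t) (at t)"
    and v': "\<And>t. a < t \<Longrightarrow> t < a + h \<Longrightarrow> (v has_vector_derivative q t) (at t)"
    and q': "\<And>t. a < t \<Longrightarrow> t < a + h \<Longrightarrow> (q has_vector_derivative r t) (at t)"
    and L: "\<And>t. a < t \<Longrightarrow> t < a + h \<Longrightarrow> norm (r t) \<le> L"
  shows "norm (y (a + h) - (y a + h *\<^sub>R v a + (h\<^sup>2 / 2) *\<^sub>R q a)) \<le> L * h ^ 3 / 6"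
proof -
  have int_bound: "norm (f x - f a) \<le> \<phi> x - \<phi> a"
    if "continuous_on {a..a + h} f" "continuous_on UNIV \<phi>"
      and "\<And>t. a < t \<Longrightarrow> t < a + h \<Longrightarrow> (f has_vector_derivative f' t) (at t)"
      and "\<And>t. a < t \<Longrightarrow> t < a + h \<Longrightarrow> (\<phi> has_real_derivative \<phi>' t) (at t)"
      and "\<And>t. a < t \<Longrightarrow> t < a + h \<Longrightarrow> norm (f' t) \<le> \<phi>' t"
      and x: "a \<le> x" "x \<le> a + h"
    for f f' :: "real \<Rightarrow> 'a" and \<phi> \<phi>' :: "real \<Rightarrow> real" and x
  proof (cases "a = x")
    case False
    show ?thesis
    proof (rule differentiable_bound_general[where f' = f' and \<phi>' = \<phi>'])
      show "continuous_on {a..x} f" "continuous_on {a..x} \<phi>"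
        using that by (auto intro: continuous_on_subset)
    qed (use that False in \<open>auto simp: has_real_derivative_iff_has_vector_derivative\<close>)
  qed simp
  have q: "norm (q x - q a) \<le> L * (x - a)" if "a \<le> x" "x \<le> a + h" for x
  proof -
    have "norm (q x - q a) \<le> L * x - L * a"
      by (rule int_bound[where f' = r and \<phi>' = "\<lambda>_. L"])
         (use cont q' L that in \<open>auto intro!: continuous_intros derivative_eq_intros\<close>)
    then show ?thesis by (simp add: algebra_simps)
  qed
  have v: "norm (v x - (v a + (x - a) *\<^sub>R q a)) \<le> L * (x - a)\<^sup>2 / 2" if "a \<le> x" "x \<le> a + h" for x
  proof -
    let ?f = "\<lambda>x. v x - (x - a) *\<^sub>R q a"
    have "norm (?f x - ?f a) \<le> L * (x - a)\<^sup>2 / 2 - L * (a - a)\<^sup>2 / 2"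
      by (rule int_bound[where f' = "\<lambda>t. q t - q a" and \<phi>' = "\<lambda>t. L * (t - a)"])
         (use cont v' q that in
           \<open>auto intro!: continuous_intros derivative_eq_intros
             simp: has_vector_derivative_def scaleR_diff_right\<close>)
    then show ?thesis by (simp add: algebra_simps)
  qed
  let ?g = "\<lambda>x. y x - (x - a) *\<^sub>R v a - ((x - a)\<^sup>2 / 2) *\<^sub>R q a"
  have g': "(?g has_vector_derivative v t - (v a + (t - a) *\<^sub>R q a)) (at t)"
    if "a < t" "t < a + h" for t
  proof -
    have "((\<lambda>x. x - a) has_real_derivative 1) (at t)"
      and "((\<lambda>x. (x - a)\<^sup>2 / 2) has_real_derivative t - a) (at t)"
      by (auto intro!: derivative_eq_intros)
    then have "(?g has_vector_derivative
        v t - ((t - a) *\<^sub>R 0 + 1 *\<^sub>R v a) - (((t - a)\<^sup>2 / 2) *\<^sub>R 0 + (t - a) *\<^sub>R q a)) (at t)"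
      by (intro has_vector_derivative_diff has_vector_derivative_scaleR
          has_vector_derivative_const y' that)
    then show ?thesis by (simp add: diff_diff_eq)
  qed
  have "norm (?g (a + h) - ?g a) \<le> L * (a + h - a) ^ 3 / 6 - L * (a - a) ^ 3 / 6"
    by (rule int_bound[OF _ _ g', where \<phi>' = "\<lambda>t. L * (t - a)\<^sup>2 / 2"])
       (use cont v \<open>0 \<le> h\<close> in \<open>auto intro!: continuous_intros derivative_eq_intros\<close>)
  then show ?thesis by (simp add: algebra_simps)
qed

section \<open>Order of the local error\<close>

theorem proposition1:
  fixes F :: "'a::banach \<Rightarrow> 'a"
    and J :: "'a \<Rightarrow> 'a \<Rightarrow>\<^sub>L 'a"
    and J2 :: "'a \<Rightarrow> 'a \<Rightarrow>\<^sub>L ('a \<Rightarrow>\<^sub>L 'a)"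
    and S :: "'a \<Rightarrow> real \<Rightarrow> 'a \<Rightarrow>\<^sub>L 'a"
    and u :: "real \<Rightarrow> 'a" and u0 :: 'a
    and T \<delta> B C \<omega> :: real
  assumes "T > 0"
    and "continuous_on {0..<T} u"
    and "u C1_differentiable_on {0<..<T}"
    and "\<And>t. t \<in> {0<..<T} \<Longrightarrow> (u has_vector_derivative F (u t)) (at t)"
    and "u 0 = u0"
    and "(u \<longlongrightarrow> u T) (at_left T)"
    and "\<delta> > 0"
    and "\<And>v. v \<in> strip u T \<delta> \<Longrightarrow> (F has_derivative blinfun_apply (J v)) (at v)"
    and "\<And>v. v \<in> strip u T \<delta> \<Longrightarrow> (J has_derivative blinfun_apply (J2 v)) (at v)"
    and "\<And>v. v \<in> strip u T \<delta> \<Longrightarrow> norm (J v) \<le> B"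
    and "\<And>v. v \<in> strip u T \<delta> \<Longrightarrow> norm (J2 v) \<le> B"
    and "\<And>v. v \<in> strip u T \<delta> \<Longrightarrow> generates (J v) (S v)"
    and "\<And>v t. v \<in> strip u T \<delta> \<Longrightarrow> t \<ge> 0 \<Longrightarrow> norm (S v t) \<le> C * exp (\<omega> * t)"
  shows "\<exists>K. \<exists>h0>0. \<forall>h N n. 0 < h \<and> h \<le> h0 \<and> real N * h = T \<and> n < N \<longrightarrow>
           norm (local_error F J S u h n) \<le> K * h ^ 3"
proof -
  note u' = assms(4) and F' = assms(8) and J' = assms(9)
  have mem: "u t \<in> strip u T \<delta>" if "t \<in> {0..T}" for t
    unfolding strip_def using that \<open>\<delta> > 0\<close> by (intro UN_I[of t]) auto
  have "0 \<le> B"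
    using \<open>T > 0\<close> by (intro order_trans[OF norm_ge_zero assms(10)[OF mem[of 0]]]) simp
  have contu: "continuous_on {0..T} u"
    unfolding continuous_on
  proof
    fix t assume t: "t \<in> {0..T}"
    show "(u \<longlongrightarrow> u t) (at t within {0..T})"
    proof (cases "t = T")
      case True
      then show ?thesis
        using assms(6) \<open>T > 0\<close> by (simp add: at_within_Icc_at_left)
    next
      case False
      then have "at t within {0..T} = at t within {0..<T}"
        using t by (intro at_within_nhd[of t "{..<T}"]) auto
      then show ?thesis
        using assms(2) t False by (auto simp: continuous_on)
    qed
  qed
  have contF: "continuous_on {0..T} (\<lambda>t. F (u t))"
  proof (intro continuous_on_compose2[OF _ contu] continuous_at_imp_continuous_on ballI)
    fix v assume "v \<in> u ` {0..T}"
    then show "isCont F v"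
      using mem by (blast intro: has_derivative_continuous F')
  qed simp
  have contJ: "continuous_on {0..T} (\<lambda>t. J (u t))"
  proof (intro continuous_on_compose2[OF _ contu] continuous_at_imp_continuous_on ballI)
    fix v assume "v \<in> u ` {0..T}"
    then show "isCont J v"
      using mem by (blast intro: has_derivative_continuous J')
  qed simp
  obtain P where P: "norm (F (u t)) \<le> P" if "t \<in> {0..T}" for t
  proof -
    have "bounded ((\<lambda>t. F (u t)) ` {0..T})"
      by (intro compact_imp_bounded compact_continuous_image contF) simp
    then obtain P where "\<forall>t\<in>{0..T}. norm (F (u t)) \<le> P"
      by (auto simp: bounded_iff)
    then show ?thesis
      using that by blast
  qed
  have "0 \<le> P"
    using \<open>T > 0\<close> by (intro order_trans[OF norm_ge_zero P[of 0]]) simp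
  define M where "M = \<bar>C\<bar> * exp (\<bar>\<omega>\<bar> * T)"
  have "0 \<le> M" by (simp add: M_def)
  have M: "norm (S (u t) s) \<le> M" if "t \<in> {0..T}" "0 \<le> s" "s \<le> T" for t s
  proof -
    have "norm (S (u t) s) \<le> C * exp (\<omega> * s)"
      using assms(13) mem that by blast
    also have "\<dots> \<le> \<bar>C\<bar> * exp (\<bar>\<omega>\<bar> * T)"
      using that by (intro mult_mono) (auto intro!: mult_mono)
    finally show ?thesis by (simp add: M_def)
  qed
  \<comment> \<open>The second and third derivatives of the solution, by the chain rule.\<close>
  define q where "q t = J (u t) (F (u t))" for t
  define r where "r t = J2 (u t) (F (u t)) (F (u t)) + J (u t) (q t)" for t
  have Fu': "((\<lambda>t. F (u t)) has_vector_derivative q t) (at t)"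
    and Ju': "((\<lambda>t. J (u t)) has_vector_derivative J2 (u t) (F (u t))) (at t)"
    if "t \<in> {0<..<T}" for t
  proof -
    have "u t \<in> strip u T \<delta>" using mem that by simp
    note FJ' = F'[OF this, THEN has_derivative_at_withinI]
      J'[OF this, THEN has_derivative_at_withinI]
    show "((\<lambda>t. F (u t)) has_vector_derivative q t) (at t)"
      using vector_derivative_diff_chain_within[OF u'[OF that] FJ'(1)] by (simp add: q_def o_def)
    show "((\<lambda>t. J (u t)) has_vector_derivative J2 (u t) (F (u t))) (at t)"
      using vector_derivative_diff_chain_within[OF u'[OF that] FJ'(2)] by (simp add: o_def)
  qed
  have q': "(q has_vector_derivative r t) (at t)" if "t \<in> {0<..<T}" for t
    using blinfun.has_vector_derivative[OF Ju' Fu', OF that that]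
    by (simp add: q_def[abs_def] r_def add.commute)
  have contq: "continuous_on {0..T} q"
    unfolding q_def[abs_def] by (intro continuous_intros contJ contF)
  have r_bound: "norm (r t) \<le> B * P * P + B * (B * P)" if "t \<in> {0..T}" for t
  proof -
    have q_le: "norm (q t) \<le> B * P"
      unfolding q_def using assms(10)[OF mem[OF that]] P[OF that] \<open>0 \<le> B\<close>
      by (intro order_trans[OF norm_blinfun] mult_mono) auto
    show ?thesis
      unfolding r_def
      using assms(10,11)[OF mem[OF that]] P[OF that] \<open>0 \<le> B\<close> \<open>0 \<le> P\<close> q_le
      by (intro norm_triangle_le add_mono order_trans[OF norm_blinfun] mult_mono) auto
  qed
  define L where "L = B * P * P + B * (B * P)"
  have "norm (local_error F J S u h n) \<le> (M * B\<^sup>2 * P + L / 6) * h ^ 3"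
    if "0 < h" "h \<le> T" "real N * h = T" "n < N" for h N n
  proof -
    define a where "a = real n * h"
    have "real (Suc n) * h \<le> real N * h"
      using that by (intro mult_right_mono) auto
    then have a: "0 \<le> a" "a + h \<le> T" "real (Suc n) * h = a + h"
      using that by (auto simp: a_def algebra_simps)
    then have a_mem: "a \<in> {0..T}" using that by auto
    define y where "y = u a + h *\<^sub>R F (u a) + (h\<^sup>2 / 2) *\<^sub>R J (u a) (F (u a))"
    have "norm (hybrid_euler_step F J S h (u a) - y)
        \<le> M * (norm (J (u a)))\<^sup>2 * norm (F (u a)) * h ^ 3"
      unfolding y_def using assms(12)[OF mem[OF a_mem]] M[OF a_mem] that
      by (intro hybrid_euler_step_bound) auto
    also have "\<dots> \<le> M * B\<^sup>2 * P * h ^ 3"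
      using assms(10)[OF mem[OF a_mem]] P[OF a_mem] \<open>0 \<le> M\<close> \<open>0 \<le> B\<close> \<open>0 < h\<close>
      by (intro mult_right_mono mult_mono power_mono) auto
    finally have step_bound: "norm (hybrid_euler_step F J S h (u a) - y) \<le> M * B\<^sup>2 * P * h ^ 3" .
    have sub: "{a..a + h} \<subseteq> {0..T}" using a by auto
    have solution_bound: "norm (u (a + h) - y) \<le> L * h ^ 3 / 6"
      unfolding y_def q_def[symmetric]
      by (rule taylor_second_order_bound[where r = r])
         (use a \<open>0 < h\<close> u' Fu' q' r_bound in
           \<open>auto simp: L_def intro: continuous_on_subset[OF _ sub] contu contF contq\<close>)
    have "local_error F J S u h n = (hybrid_euler_step F J S h (u a) - y) - (u (a + h) - y)"
      by (simp only: local_error_def a(3) a_def[symmetric]) simp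
    also have "norm \<dots> \<le> M * B\<^sup>2 * P * h ^ 3 + L * h ^ 3 / 6"
      by (intro order_trans[OF norm_triangle_ineq4] add_mono step_bound solution_bound)
    finally show ?thesis by (simp add: algebra_simps)
  qed
  then show ?thesis
    using \<open>T > 0\<close> by blast
qed

end
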